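(* For every $t$-tuple of positive integers $(m_1,m_2,\dots,m_t)$ there are series-parallel graphs $H_1,H_2$ such that $\Delta\rho(H_1,H_2)=\Delta\hat\rho(H_1,H_2)$ and this function has profile $(m_1,m_2,\dots,m_t)$.
   Context: Graphs have distinguished sender $s$ and receiver $r$. $G_1\circ G_2$ identifies the receiver of $G_1$ with the sender of $G_2$ (sender $s_1$, receiver $r_2$); $G_1\|G_2$ identifies senders and receivers; series-parallel graphs are those built from $K_2$ by these operations. Each edge survives independently with probability $p\in(0,1)$. $\rho(G,p)$ is the probability that $s,r$ are in the same component of the surviving subgraph. An instruction is a triple $uvw$ with $u,w$ distinct neighbors of $v$; a protocol $A$ is a set of instructions; an $A$-walk is an $s,r$-walk all of whose consecutive triples lie in $A$; $A$ is finite if there are finitely many $A$-walks; $\rho_A(G,p)$ is the probability that all edges of some $A$-walk survive; $\hat\rho(G,p)=\max\{\rho_A(G,p):A$ finite$\}$. $\Delta\rho(G,H)(p)=\rho(G,p)-\rho(H,p)$ and $\Delta\hat\rho(G,H)(p)=\hat\rho(G,p)-\hat\rho(H,p)$. A function has profile $(m_1,\dots,m_t)$ if it has exactly $t$ zeroes $x_1<\dots<x_t$ in $(0,1)$, with $x_i$ of multiplicity $m_i$. *)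

theory Defs
  imports "HOL-Probability.Probability"
begin

(* Finite simple graphs with a sender and a receiver; an edge is the two-element set of its ends. *)
record 'v network =
  verts :: "'v set"
  edges :: "'v set set"
  sender :: 'v
  receiver :: 'v

definition K2 :: "'v \<Rightarrow> 'v \<Rightarrow> 'v network" where
  "K2 s r = \<lparr>verts = {s, r}, edges = {{s, r}}, sender = s, receiver = r\<rparr>"

(* Gluing is done on representatives: the two graphs must already share exactly the vertices
   to be identified, and the composition is then a union. *)
definition series :: "'v network \<Rightarrow> 'v network \<Rightarrow> 'v network" where
  "series G1 G2 = \<lparr>verts = verts G1 \<union> verts G2, edges = edges G1 \<union> edges G2,
                   sender = sender G1, receiver = receiver G2\<rparr>"

definition parallel :: "'v network \<Rightarrow> 'v network \<Rightarrow> 'v network" where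
  "parallel G1 G2 = \<lparr>verts = verts G1 \<union> verts G2, edges = edges G1 \<union> edges G2,
                     sender = sender G1, receiver = receiver G1\<rparr>"

(* Since K2 may be placed on any two vertices, over an infinite vertex type every isomorphism
   class is represented.  The condition that no edge is shared in a parallel composition only
   excludes the case where both parts contain the edge joining sender and receiver,
   whose composition would have a double edge. *)
inductive series_parallel :: "'v network \<Rightarrow> bool" where
  K2: "s \<noteq> r \<Longrightarrow> series_parallel (K2 s r)"
| series: "series_parallel G1 \<Longrightarrow> series_parallel G2 \<Longrightarrow>
    receiver G1 = sender G2 \<Longrightarrow> verts G1 \<inter> verts G2 = {receiver G1} \<Longrightarrow>
    series_parallel (series G1 G2)"
| parallel: "series_parallel G1 \<Longrightarrow> series_parallel G2 \<Longrightarrow>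
    sender G1 = sender G2 \<Longrightarrow> receiver G1 = receiver G2 \<Longrightarrow>
    verts G1 \<inter> verts G2 = {sender G1, receiver G1} \<Longrightarrow>
    edges G1 \<inter> edges G2 = {} \<Longrightarrow>
    series_parallel (parallel G1 G2)"

lemma series_parallel_simple:
  assumes "series_parallel G"
  shows "finite (verts G) \<and> {sender G, receiver G} \<subseteq> verts G \<and> sender G \<noteq> receiver G \<and>
         edges G \<subseteq> {e. e \<subseteq> verts G \<and> card e = 2}"
  using assms
proof induction
  case (series G1 G2)
  have "sender G1 \<noteq> receiver G2"
  proof
    assume "sender G1 = receiver G2"
    with series have "sender G1 \<in> verts G1 \<inter> verts G2" by auto
    with series show False by auto
  qed
  with series show ?case by (auto simp: series_def)
qed (auto simp: K2_def parallel_def)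

(* The random set of surviving edges. *)
definition surviving :: "'v network \<Rightarrow> real \<Rightarrow> 'v set set pmf" where
  "surviving G p =
     map_pmf (\<lambda>\<omega>. {e \<in> edges G. \<omega> e}) (Pi_pmf (edges G) False (\<lambda>_. bernoulli_pmf p))"

definition same_component :: "'v set set \<Rightarrow> 'v \<Rightarrow> 'v \<Rightarrow> bool" where
  "same_component F = (\<lambda>u v. {u, v} \<in> F)\<^sup>*\<^sup>*"

definition rho :: "'v network \<Rightarrow> real \<Rightarrow> real" where
  "rho G p = measure_pmf.prob (surviving G p) {F. same_component F (sender G) (receiver G)}"

(* The triple (u, v, w) is the instruction uvw. *)
definition instructions :: "'v network \<Rightarrow> ('v \<times> 'v \<times> 'v) set" where
  "instructions G = {(u, v, w). {u, v} \<in> edges G \<and> {v, w} \<in> edges G \<and> u \<noteq> w}"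

definition walk_edges :: "'v list \<Rightarrow> 'v set set" where
  "walk_edges w = {{w ! i, w ! Suc i} | i. Suc i < length w}"

(* A walk is the list of its vertices; vertices and edges may be repeated. *)
definition A_walk :: "'v network \<Rightarrow> ('v \<times> 'v \<times> 'v) set \<Rightarrow> 'v list \<Rightarrow> bool" where
  "A_walk G A w \<longleftrightarrow>
     w \<noteq> [] \<and> hd w = sender G \<and> last w = receiver G \<and> walk_edges w \<subseteq> edges G \<and>
     (\<forall>i. i + 2 < length w \<longrightarrow> (w ! i, w ! (i + 1), w ! (i + 2)) \<in> A)"

definition finite_protocol :: "'v network \<Rightarrow> ('v \<times> 'v \<times> 'v) set \<Rightarrow> bool" where
  "finite_protocol G A \<longleftrightarrow> A \<subseteq> instructions G \<and> finite {w. A_walk G A w}"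

definition rho_protocol :: "'v network \<Rightarrow> ('v \<times> 'v \<times> 'v) set \<Rightarrow> real \<Rightarrow> real" where
  "rho_protocol G A p =
     measure_pmf.prob (surviving G p) {F. \<exists>w. A_walk G A w \<and> walk_edges w \<subseteq> F}"

definition rho_hat :: "'v network \<Rightarrow> real \<Rightarrow> real" where
  "rho_hat G p = Max {rho_protocol G A p | A. finite_protocol G A}"

definition Delta_rho :: "'v network \<Rightarrow> 'v network \<Rightarrow> real \<Rightarrow> real" where
  "Delta_rho G H p = rho G p - rho H p"

definition Delta_rho_hat :: "'v network \<Rightarrow> 'v network \<Rightarrow> real \<Rightarrow> real" where
  "Delta_rho_hat G H p = rho_hat G p - rho_hat H p"

(* The local form of "(X - x)^m is the exact power of X - x dividing f"; for polynomial
   functions f it agrees with the order of x as a root of f.  It determines m, and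
   applies to functions such as rho_hat that are not given as polynomials. *)
definition zero_of_multiplicity :: "(real \<Rightarrow> real) \<Rightarrow> real \<Rightarrow> nat \<Rightarrow> bool" where
  "zero_of_multiplicity f x m \<longleftrightarrow>
     m > 0 \<and> (\<exists>g. isCont g x \<and> g x \<noteq> 0 \<and> (\<forall>\<^sub>F y in nhds x. f y = (y - x) ^ m * g y))"

definition has_profile :: "(real \<Rightarrow> real) \<Rightarrow> nat list \<Rightarrow> bool" where
  "has_profile f ms \<longleftrightarrow>
     (\<exists>xs. length xs = length ms \<and> sorted_wrt (<) xs \<and> set xs = {x \<in> {0<..<1}. f x = 0} \<and>
           (\<forall>i<length ms. zero_of_multiplicity f (xs ! i) (ms ! i)))"

end

theory Submission
  imports Defs
begin

text \<open>On a series-parallel graph the protocol that always moves away from the sender is finite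
  and contains every path, so \<open>\<rho>\<close> and its finite-protocol version agree.
  Series composition multiplies reliabilities and parallel composition of \<open>a\<close> and \<open>b\<close> yields
  \<open>a + b - ab\<close>; hence
  \<open>(a - b) (c - d) = (ac + bd - acbd) - (ad + bc - adbc)\<close>
  shows that differences of reliabilities are closed under products.  It remains to find
  differences with a single simple zero in \<open>(0,1)\<close>, at infinitely many different places: replacing
  every edge by a path of length \<open>k\<close> in one such pair moves the zero from \<open>x\<close> to \<open>x\<^sup>1\<^sup>/\<^sup>k\<close>.\<close>

section \<open>Series-parallel structure\<close>

lemma same_component_mono:
  assumes "same_component F u v" "F \<subseteq> F'"
  shows "same_component F' u v"
  using assms unfolding same_component_def
  by (metis (mono_tags, lifting) rtranclp_mono predicate2D predicate2I subsetD)

lemma same_component_step: "same_component F u v \<Longrightarrow> {v, w} \<in> F \<Longrightarrow> same_component F u w"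
  unfolding same_component_def by (rule rtranclp.rtrancl_into_rtrancl)

lemma same_component_refl [simp]: "same_component F u u"
  by (simp add: same_component_def)

lemma same_component_trans: "same_component F u v \<Longrightarrow> same_component F v w \<Longrightarrow> same_component F u w"
  unfolding same_component_def by (rule rtranclp_trans)

text \<open>The vertex \<open>m\<close> separates the two parts, so a walk changes sides only
  there.\<close>

lemma same_component_series:
  assumes F: "F1 \<subseteq> Pow V1" "F2 \<subseteq> Pow V2" and V: "V1 \<inter> V2 = {m}" and s: "s \<in> V1" and r: "r \<in> V2"
  shows "same_component (F1 \<union> F2) s r \<longleftrightarrow> same_component F1 s m \<and> same_component F2 m r"
proof
  assume "same_component (F1 \<union> F2) s r"
  then have "(\<lambda>u v. {u, v} \<in> F1 \<union> F2)\<^sup>*\<^sup>* s r" by (simp add: same_component_def)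
  \<comment> \<open>The invariant speaks of the current vertex of the walk. Both implications apply
    at \<open>m\<close>, so it survives crossings of \<open>m\<close> in either direction.\<close>
  then have "(r \<in> V1 \<longrightarrow> same_component F1 s r) \<and>
      (r \<in> V2 \<longrightarrow> same_component F1 s m \<and> same_component F2 m r) \<and> r \<in> V1 \<union> V2"
  proof induction
    case base
    have "s = m" if "s \<in> V2" using V s that by blast
    then show ?case using s by auto
  next
    case (step v w)
    from step.hyps(2) consider "{v, w} \<in> F1" | "{v, w} \<in> F2" by blast
    then show ?case
    proof cases
      case 1
      then have "v \<in> V1" "w \<in> V1" using F by auto
      with step.IH 1 have "same_component F1 s w" by (blast intro: same_component_step)
      moreover have "w = m" if "w \<in> V2" using \<open>w \<in> V1\<close> V that by blast
      ultimately show ?thesis using \<open>w \<in> V1\<close> by auto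
    next
      case 2
      then have "v \<in> V2" "w \<in> V2" using F by auto
      with step.IH 2 have "same_component F1 s m" "same_component F2 m w"
        by (blast intro: same_component_step)+
      moreover have "w = m" if "w \<in> V1" using \<open>w \<in> V2\<close> V that by blast
      ultimately show ?thesis using \<open>w \<in> V2\<close> by auto
    qed
  qed
  with r show "same_component F1 s m \<and> same_component F2 m r" by blast
next
  assume "same_component F1 s m \<and> same_component F2 m r"
  then show "same_component (F1 \<union> F2) s r"
    by (meson same_component_mono same_component_trans sup_ge1 sup_ge2)
qed

text \<open>A walk from \<open>s\<close> can change parts only at \<open>s\<close>, where it starts
  afresh, or at \<open>r\<close>, where it has already succeeded inside one part.\<close>

lemma same_component_parallel:
  assumes F: "F1 \<subseteq> Pow V1" "F2 \<subseteq> Pow V2" and V: "V1 \<inter> V2 = {s, r}"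
  shows "same_component (F1 \<union> F2) s r \<longleftrightarrow> same_component F1 s r \<or> same_component F2 s r"
proof
  assume "same_component (F1 \<union> F2) s r"
  then have "(\<lambda>u v. {u, v} \<in> F1 \<union> F2)\<^sup>*\<^sup>* s r" by (simp add: same_component_def)
  then have "same_component F1 s r \<or> same_component F2 s r \<or>
      (r \<in> V1 \<longrightarrow> same_component F1 s r) \<and> (r \<in> V2 \<longrightarrow> same_component F2 s r)"
    (is "?C \<or> ?D \<or> ?I r")
  \<comment> \<open>The predicate is spelled out because \<open>r\<close> must stay fixed in the
    absorbing disjuncts \<open>?C\<close> and \<open>?D\<close> while the current vertex
    varies.\<close>
  proof (induction rule: rtranclp_induct[where P = "\<lambda>v. ?C \<or> ?D \<or>
      (v \<in> V1 \<longrightarrow> same_component F1 s v) \<and> (v \<in> V2 \<longrightarrow> same_component F2 s v)"])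
    case base
    then show ?case by auto
  next
    case (step v w)
    from step.hyps(2) consider "{v, w} \<in> F1" | "{v, w} \<in> F2" by blast
    then show ?case
    proof cases
      case 1
      then have "v \<in> V1" "w \<in> V1" using F by auto
      with step.IH 1 have "?C \<or> ?D \<or> same_component F1 s w" by (blast intro: same_component_step)
      moreover have "w = s \<or> w = r" if "w \<in> V2" using \<open>w \<in> V1\<close> V that by blast
      ultimately show ?thesis by auto
    next
      case 2
      then have "v \<in> V2" "w \<in> V2" using F by auto
      with step.IH 2 have "?C \<or> ?D \<or> same_component F2 s w" by (blast intro: same_component_step)
      moreover have "w = s \<or> w = r" if "w \<in> V1" using \<open>w \<in> V2\<close> V that by blast
      ultimately show ?thesis by auto
    qed
  qed
  with V show "same_component F1 s r \<or> same_component F2 s r" by blast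
next
  assume "same_component F1 s r \<or> same_component F2 s r"
  then show "same_component (F1 \<union> F2) s r"
    by (meson same_component_mono sup_ge1 sup_ge2)
qed

lemma series_parallel_edges_Pow: "series_parallel G \<Longrightarrow> edges G \<subseteq> Pow (verts G)"
  using series_parallel_simple by auto

lemma series_parallel_finite_edges: "series_parallel G \<Longrightarrow> finite (edges G)"
  by (rule finite_subset[OF series_parallel_edges_Pow]) (auto dest: series_parallel_simple)

lemma series_parallel_verts:
  assumes "series_parallel G"
  shows "sender G \<in> verts G" "receiver G \<in> verts G" "sender G \<noteq> receiver G" "finite (verts G)"
  using series_parallel_simple[OF assms] by auto

lemma edges_disjoint_series:
  assumes "series_parallel G1" "series_parallel G2" "verts G1 \<inter> verts G2 = {receiver G1}"
  shows "edges G1 \<inter> edges G2 = {}"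
proof (rule ccontr)
  assume "edges G1 \<inter> edges G2 \<noteq> {}"
  then obtain e where "e \<in> edges G1" "e \<in> edges G2" by auto
  then have "e \<subseteq> verts G1 \<inter> verts G2" "card e = 2"
    using assms(1,2)[THEN series_parallel_simple] by auto
  then have "card e \<le> 1" using assms(3) card_mono[of "{receiver G1}" e] by simp
  with \<open>card e = 2\<close> show False by simp
qed

section \<open>Reliability of series and parallel compositions\<close>

lemma prob_pair_pmf_Times:
  "measure_pmf.prob (pair_pmf M N) (A \<times> B) = measure_pmf.prob M A * measure_pmf.prob N B"
proof -
  \<comment> \<open>The product rule is available for countable sets, so both factors are first cut
    down to the supports.\<close>
  have "measure_pmf.prob (pair_pmf M N) (A \<times> B) =
      measure_pmf.prob (pair_pmf M N) ((A \<inter> set_pmf M) \<times> (B \<inter> set_pmf N))"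
    by (subst measure_Int_set_pmf[symmetric]) (simp add: Times_Int_Times)
  also have "\<dots> = measure_pmf.prob M (A \<inter> set_pmf M) * measure_pmf.prob N (B \<inter> set_pmf N)"
    by (rule measure_pmf_prob_product) (auto intro: countable_Int2)
  finally show ?thesis by (simp add: measure_Int_set_pmf)
qed

lemma set_pmf_surviving: "set_pmf (surviving G p) \<subseteq> Pow (edges G)"
  by (auto simp: surviving_def)

lemma surviving_Pow_verts:
  assumes "series_parallel G" "F \<in> set_pmf (surviving G p)"
  shows "F \<subseteq> Pow (verts G)"
proof -
  have "F \<subseteq> edges G" using assms(2) set_pmf_surviving by (metis PowD subsetD)
  also have "\<dots> \<subseteq> Pow (verts G)" by (rule series_parallel_edges_Pow[OF assms(1)])
  finally show ?thesis .
qed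

text \<open>Edges survive independently, so disjoint edge sets have independent sets of
  survivors.\<close>

lemma surviving_union:
  assumes "edges G = edges G1 \<union> edges G2" "edges G1 \<inter> edges G2 = {}"
    "finite (edges G1)" "finite (edges G2)"
  shows "surviving G p = map_pmf (\<lambda>(F1, F2). F1 \<union> F2) (pair_pmf (surviving G1 p) (surviving G2 p))"
  unfolding surviving_def assms(1) map_pair[symmetric]
  using assms(2-4)
  by (subst Pi_pmf_union) (auto simp: map_pmf_comp intro!: map_pmf_cong)

lemma rho_series:
  assumes "series_parallel G1" "series_parallel G2"
    "receiver G1 = sender G2" "verts G1 \<inter> verts G2 = {receiver G1}"
  shows "rho (series G1 G2) p = rho G1 p * rho G2 p"
proof -
  let ?G = "series G1 G2" and ?M = "pair_pmf (surviving G1 p) (surviving G2 p)"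
  let ?C = "\<lambda>G. {F. same_component F (sender G) (receiver G)}"
  have *: "surviving ?G p = map_pmf (\<lambda>(F1, F2). F1 \<union> F2) ?M"
    using assms edges_disjoint_series[OF assms(1,2,4)]
    by (intro surviving_union) (auto simp: series_def series_parallel_finite_edges)
  have "rho ?G p = measure_pmf.prob ?M ((\<lambda>(F1, F2). F1 \<union> F2) -` ?C ?G)"
    by (simp add: rho_def *)
  \<comment> \<open>The events are compared only on sets of edges of the two graphs, where
    \<open>same_component_series\<close> applies; these carry all the probability.\<close>
  also have "\<dots> = measure_pmf.prob ?M (?C G1 \<times> ?C G2)"
  proof (rule measure_eq_AE)
    have "(F1, F2) \<in> (\<lambda>(F1, F2). F1 \<union> F2) -` ?C ?G \<longleftrightarrow> (F1, F2) \<in> ?C G1 \<times> ?C G2"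
      if "F1 \<in> set_pmf (surviving G1 p)" "F2 \<in> set_pmf (surviving G2 p)" for F1 F2
    proof -
      have "F1 \<subseteq> Pow (verts G1)" "F2 \<subseteq> Pow (verts G2)"
        by (rule surviving_Pow_verts; fact assms that)+
      with assms show ?thesis
        by (simp add: series_def same_component_series[of F1 "verts G1" F2 "verts G2" "sender G2"] series_parallel_verts)
    qed
    then show "AE x in ?M. x \<in> (\<lambda>(F1, F2). F1 \<union> F2) -` ?C ?G \<longleftrightarrow> x \<in> ?C G1 \<times> ?C G2"
      by (auto simp: AE_measure_pmf_iff)
  qed auto
  also have "\<dots> = rho G1 p * rho G2 p"
    by (simp add: prob_pair_pmf_Times rho_def)
  finally show ?thesis .
qed

text \<open>A parallel composition fails exactly when both parts fail, so the failure probabilities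
  multiply.\<close>

lemma rho_parallel:
  assumes "series_parallel G1" "series_parallel G2"
    "sender G1 = sender G2" "receiver G1 = receiver G2"
    "verts G1 \<inter> verts G2 = {sender G1, receiver G1}" "edges G1 \<inter> edges G2 = {}"
  shows "rho (parallel G1 G2) p = rho G1 p + rho G2 p - rho G1 p * rho G2 p"
proof -
  let ?G = "parallel G1 G2" and ?M = "pair_pmf (surviving G1 p) (surviving G2 p)"
  let ?C = "\<lambda>G. {F. same_component F (sender G) (receiver G)}"
  have *: "surviving ?G p = map_pmf (\<lambda>(F1, F2). F1 \<union> F2) ?M"
    using assms by (intro surviving_union) (auto simp: parallel_def series_parallel_finite_edges)
  have compl: "measure_pmf.prob (surviving G p) (- ?C G) = 1 - rho G p" for G :: "'a network"
    using measure_pmf.prob_compl[of "?C G" "surviving G p"] by (simp add: rho_def Compl_eq_Diff_UNIV)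
  have "1 - rho ?G p = measure_pmf.prob ?M ((\<lambda>(F1, F2). F1 \<union> F2) -` (- ?C ?G))"
    unfolding compl[symmetric] * by simp
  also have "\<dots> = measure_pmf.prob ?M ((- ?C G1) \<times> (- ?C G2))"
  proof (rule measure_eq_AE)
    have "(F1, F2) \<in> (\<lambda>(F1, F2). F1 \<union> F2) -` (- ?C ?G) \<longleftrightarrow> (F1, F2) \<in> (- ?C G1) \<times> (- ?C G2)"
      if "F1 \<in> set_pmf (surviving G1 p)" "F2 \<in> set_pmf (surviving G2 p)" for F1 F2
    proof -
      have "F1 \<subseteq> Pow (verts G1)" "F2 \<subseteq> Pow (verts G2)"
        by (rule surviving_Pow_verts; fact assms that)+
      with assms show ?thesis
        by (simp add: parallel_def same_component_parallel[of F1 "verts G1" F2 "verts G2"])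
    qed
    then show "AE x in ?M. x \<in> (\<lambda>(F1, F2). F1 \<union> F2) -` (- ?C ?G) \<longleftrightarrow> x \<in> (- ?C G1) \<times> (- ?C G2)"
      by (auto simp: AE_measure_pmf_iff)
  qed auto
  also have "\<dots> = (1 - rho G1 p) * (1 - rho G2 p)"
    by (simp add: prob_pair_pmf_Times compl)
  finally show ?thesis by (simp add: algebra_simps)
qed

lemma rho_K2:
  assumes "s \<noteq> r" "p \<in> {0..1}"
  shows "rho (K2 s r) p = p"
proof -
  have *: "same_component {e. e = {s, r} \<and> b} s r \<longleftrightarrow> b" for b
  proof (cases b)
    case True
    then show ?thesis using same_component_step[of _ s s r] by simp
  next
    case False
    then show ?thesis using assms(1) by (auto simp: same_component_def elim: converse_rtranclpE)
  qed
  have "rho (K2 s r) p = measure_pmf.prob (bernoulli_pmf p) {b. b}"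
    using * by (simp add: rho_def surviving_def K2_def Pi_pmf_singleton map_pmf_comp vimage_def
        cong: conj_cong)
  also have "{b. b} = {True}" by auto
  also have "measure_pmf.prob (bernoulli_pmf p) {True} = p"
    using assms(2) by (simp add: measure_pmf_single)
  finally show ?thesis .
qed

section \<open>Optimal finite protocols on series-parallel graphs\<close>

text \<open>Every path through a series-parallel graph increases a common rank function, so the
  instructions that increase the rank form a finite protocol containing all paths.\<close>

lemma series_parallel_rank:
  assumes "series_parallel G"
  shows "\<exists>h :: 'a \<Rightarrow> real. h (sender G) = 0 \<and> h (receiver G) = 1 \<and>
    (\<forall>F \<subseteq> edges G. same_component F (sender G) (receiver G) \<longrightarrow>
       (\<lambda>u v. {u, v} \<in> F \<and> h u < h v)\<^sup>*\<^sup>* (sender G) (receiver G))"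
  using assms
proof induction
  case (K2 s r)
  have "{s, r} \<in> F" if "F \<subseteq> {{s, r}}" "same_component F s r" for F
  proof (rule ccontr)
    assume "{s, r} \<notin> F"
    with that have "F = {}" by blast
    with that K2 show False by (auto simp: same_component_def elim: converse_rtranclpE)
  qed
  with K2 show ?case
    by (intro exI[of _ "\<lambda>v. if v = r then 1 else 0"]) (auto simp: K2_def intro!: r_into_rtranclp)
next
  case (series G1 G2)
  obtain h1 :: "'a \<Rightarrow> real" where h1: "h1 (sender G1) = 0" "h1 (receiver G1) = 1"
    "\<And>F. F \<subseteq> edges G1 \<Longrightarrow> same_component F (sender G1) (receiver G1) \<Longrightarrow>
       (\<lambda>u v. {u, v} \<in> F \<and> h1 u < h1 v)\<^sup>*\<^sup>* (sender G1) (receiver G1)"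
    using series.IH(1) by blast
  obtain h2 :: "'a \<Rightarrow> real" where h2: "h2 (sender G2) = 0" "h2 (receiver G2) = 1"
    "\<And>F. F \<subseteq> edges G2 \<Longrightarrow> same_component F (sender G2) (receiver G2) \<Longrightarrow>
       (\<lambda>u v. {u, v} \<in> F \<and> h2 u < h2 v)\<^sup>*\<^sup>* (sender G2) (receiver G2)"
    using series.IH(2) by blast
  \<comment> \<open>The end values of \<open>h1\<close> become 0 and 1/2, those of \<open>h2\<close>
    become 1/2 and 1, so both formulas agree at the shared vertex.\<close>
  define h where "h v = (if v \<in> verts G1 then h1 v / 2 else (1 + h2 v) / 2)" for v
  have hV1: "h v = h1 v / 2" if "v \<in> verts G1" for v using that by (simp add: h_def)
  have hV2: "h v = (1 + h2 v) / 2" if "v \<in> verts G2" for v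
  proof (cases "v \<in> verts G1")
    case True
    then have "v = receiver G1" using that series.hyps by blast
    then show ?thesis using True h1 h2 series.hyps by (auto simp: h_def)
  qed (simp add: h_def)
  note E1 = series_parallel_edges_Pow[OF series.hyps(1)]
  note E2 = series_parallel_edges_Pow[OF series.hyps(2)]
  have ends1: "u \<in> verts G1 \<and> v \<in> verts G1" if "{u, v} \<in> edges G1" for u v using E1 that by auto
  have ends2: "u \<in> verts G2 \<and> v \<in> verts G2" if "{u, v} \<in> edges G2" for u v using E2 that by auto
  have "(\<lambda>u v. {u, v} \<in> F \<and> h u < h v)\<^sup>*\<^sup>* (sender G1) (receiver G2)"
    if F: "F \<subseteq> edges G1 \<union> edges G2" "same_component F (sender G1) (receiver G2)" for F
  proof -
    let ?F1 = "F \<inter> edges G1" and ?F2 = "F \<inter> edges G2"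
    have "F = ?F1 \<union> ?F2" using F by auto
    then have "same_component (?F1 \<union> ?F2) (sender G1) (receiver G2)" using F by simp
    then have c: "same_component ?F1 (sender G1) (receiver G1)" "same_component ?F2 (sender G2) (receiver G2)"
      using same_component_series[of ?F1 "verts G1" ?F2 "verts G2" "receiver G1" "sender G1" "receiver G2"]
        series.hyps E1 E2 series_parallel_verts by fastforce+
    have "(\<lambda>u v. {u, v} \<in> F \<and> h u < h v)\<^sup>*\<^sup>* (sender G1) (receiver G1)"
      by (rule mono_rtranclp[rule_format, OF _ h1(3)[OF _ c(1)]]) (auto dest!: ends1 simp: hV1)
    moreover have "(\<lambda>u v. {u, v} \<in> F \<and> h u < h v)\<^sup>*\<^sup>* (sender G2) (receiver G2)"
      by (rule mono_rtranclp[rule_format, OF _ h2(3)[OF _ c(2)]]) (auto dest!: ends2 simp: hV2)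
    ultimately show ?thesis using series.hyps(3) by simp
  qed
  moreover have "h (sender G1) = 0" "h (receiver G2) = 1"
    using series.hyps(1,2) by (simp_all add: h1(1) h2(2) hV1 hV2 series_parallel_verts)
  ultimately show ?case by (auto simp: series_def)
next
  case (parallel G1 G2)
  obtain h1 :: "'a \<Rightarrow> real" where h1: "h1 (sender G1) = 0" "h1 (receiver G1) = 1"
    "\<And>F. F \<subseteq> edges G1 \<Longrightarrow> same_component F (sender G1) (receiver G1) \<Longrightarrow>
       (\<lambda>u v. {u, v} \<in> F \<and> h1 u < h1 v)\<^sup>*\<^sup>* (sender G1) (receiver G1)"
    using parallel.IH(1) by blast
  obtain h2 :: "'a \<Rightarrow> real" where h2: "h2 (sender G2) = 0" "h2 (receiver G2) = 1"
    "\<And>F. F \<subseteq> edges G2 \<Longrightarrow> same_component F (sender G2) (receiver G2) \<Longrightarrow>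
       (\<lambda>u v. {u, v} \<in> F \<and> h2 u < h2 v)\<^sup>*\<^sup>* (sender G2) (receiver G2)"
    using parallel.IH(2) by blast
  \<comment> \<open>The normalisation to 0 at the sender and 1 at the receiver makes
    \<open>h1\<close> and \<open>h2\<close> agree on both shared vertices.\<close>
  define h where "h v = (if v \<in> verts G1 then h1 v else h2 v)" for v
  have hV1: "h v = h1 v" if "v \<in> verts G1" for v using that by (simp add: h_def)
  have hV2: "h v = h2 v" if "v \<in> verts G2" for v
  proof (cases "v \<in> verts G1")
    case True
    then have "v = sender G1 \<or> v = receiver G1" using that parallel.hyps by blast
    then show ?thesis using True h1 h2 parallel.hyps by (auto simp: h_def)
  qed (simp add: h_def)
  note E1 = series_parallel_edges_Pow[OF parallel.hyps(1)]
  note E2 = series_parallel_edges_Pow[OF parallel.hyps(2)]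
  have ends1: "u \<in> verts G1 \<and> v \<in> verts G1" if "{u, v} \<in> edges G1" for u v using E1 that by auto
  have ends2: "u \<in> verts G2 \<and> v \<in> verts G2" if "{u, v} \<in> edges G2" for u v using E2 that by auto
  have "(\<lambda>u v. {u, v} \<in> F \<and> h u < h v)\<^sup>*\<^sup>* (sender G1) (receiver G1)"
    if F: "F \<subseteq> edges G1 \<union> edges G2" "same_component F (sender G1) (receiver G1)" for F
  proof -
    let ?F1 = "F \<inter> edges G1" and ?F2 = "F \<inter> edges G2"
    have "F = ?F1 \<union> ?F2" using F by auto
    then have "same_component (?F1 \<union> ?F2) (sender G1) (receiver G1)" using F by simp
    then consider "same_component ?F1 (sender G1) (receiver G1)"
      | "same_component ?F2 (sender G2) (receiver G2)"
      using same_component_parallel[of ?F1 "verts G1" ?F2 "verts G2" "sender G1" "receiver G1"]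
        parallel.hyps E1 E2 by fastforce
    then show ?thesis
    proof cases
      case 1
      show ?thesis
        by (rule mono_rtranclp[rule_format, OF _ h1(3)[OF _ 1]]) (auto dest!: ends1 simp: hV1)
    next
      case 2
      have "(\<lambda>u v. {u, v} \<in> F \<and> h u < h v)\<^sup>*\<^sup>* (sender G2) (receiver G2)"
        by (rule mono_rtranclp[rule_format, OF _ h2(3)[OF _ 2]]) (auto dest!: ends2 simp: hV2)
      then show ?thesis using parallel.hyps by simp
    qed
  qed
  moreover have "h (sender G1) = 0" "h (receiver G1) = 1"
    using parallel.hyps(1) by (simp_all add: h1(1,2) hV1 series_parallel_verts)
  ultimately show ?case by (auto simp: parallel_def)
qed

section \<open>Walks and the protocol of a rank function\<close>

lemma rtranclp_walk:
  assumes "R\<^sup>*\<^sup>* x y"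
  obtains w where "w \<noteq> []" "hd w = x" "last w = y" "successively R w"
proof -
  from assms have "\<exists>w. w \<noteq> [] \<and> hd w = x \<and> last w = y \<and> successively R w"
  proof induction
    case base
    show ?case by (intro exI[of _ "[x]"]) simp
  next
    case (step y z)
    then obtain w where "w \<noteq> []" "hd w = x" "last w = y" "successively R w" by blast
    with step.hyps(2) show ?case
      by (intro exI[of _ "w @ [z]"]) (simp add: successively_append_iff)
  qed
  with that show ?thesis by blast
qed

lemma walk_same_component:
  assumes "w \<noteq> []" "walk_edges w \<subseteq> F"
  shows "same_component F (hd w) (last w)"
proof -
  have "same_component F (w ! 0) (w ! i)" if "i < length w" for i
    using that
  proof (induction i)
    case (Suc i)
    then have "{w ! i, w ! Suc i} \<in> F" using assms(2) unfolding walk_edges_def by blast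
    with Suc show ?case by (auto intro: same_component_step)
  qed simp
  with assms(1) show ?thesis by (simp add: hd_conv_nth last_conv_nth)
qed

lemma rho_protocol_le_rho: "rho_protocol G A p \<le> rho G p"
  unfolding rho_protocol_def rho_def
proof (rule measure_pmf.finite_measure_mono)
  show "{F. \<exists>w. A_walk G A w \<and> walk_edges w \<subseteq> F} \<subseteq> {F. same_component F (sender G) (receiver G)}"
    using walk_same_component unfolding A_walk_def by fastforce
qed simp

text \<open>The rank rises strictly along a walk with at least one triple, so no vertex repeats; a
  finite vertex set has only finitely many lists without repetition.\<close>

lemma finite_protocol_rank:
  fixes h :: "'v \<Rightarrow> real"
  assumes V: "finite (verts G)" "edges G \<subseteq> Pow (verts G)" "sender G \<in> verts G" "sender G \<noteq> receiver G"
  defines "A \<equiv> {(u, v, w). {u, v} \<in> edges G \<and> {v, w} \<in> edges G \<and> h u < h v \<and> h v < h w}"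
  shows "finite_protocol G A"
  unfolding finite_protocol_def
proof
  show "A \<subseteq> instructions G" by (auto simp: A_def instructions_def)
  have "set w \<subseteq> verts G \<and> distinct w" if w: "A_walk G A w" for w
  proof
    note W = w[unfolded A_walk_def]
    have E: "{w ! i, w ! Suc i} \<in> edges G" if "Suc i < length w" for i
      using W that by (auto simp: walk_edges_def)
    have "w ! i \<in> verts G" if "i < length w" for i
    proof (cases i)
      case 0
      then show ?thesis using W V by (simp add: hd_conv_nth[symmetric])
    next
      case (Suc j)
      then show ?thesis using E[of j] that V(2) by auto
    qed
    then show "set w \<subseteq> verts G" by (auto simp: in_set_conv_nth)
    show "distinct w"
    \<comment> \<open>Walks with at most two vertices contain no triple, so the protocol does not
      constrain them; here the distinct ends suffice.\<close>
    proof (cases "length w \<le> 2")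
      case True
      then consider a where "w = [a]" | a b where "w = [a, b]" using W
        by (cases w; cases "tl w") (auto simp: neq_Nil_conv)
      then show ?thesis using W V(4) by cases auto
    next
      case False
      \<comment> \<open>The first edge rises by the first triple; every later edge is the second
        edge of the triple starting one step earlier.\<close>
      have "h (w ! i) < h (w ! Suc i)" if "Suc i < length w" for i
      proof (cases i)
        case 0
        have "(w ! 0, w ! 1, w ! 2) \<in> A"
          using W False by (metis (no_types, lifting) add_0 not_le)
        with 0 show ?thesis by (simp add: A_def)
      next
        case (Suc j)
        have "(w ! j, w ! (j + 1), w ! (j + 2)) \<in> A" using W that Suc by simp
        with Suc show ?thesis by (simp add: A_def)
      qed
      then have "successively (\<lambda>x y. h x < h y) w" by (simp add: successively_conv_nth)
      then have "sorted_wrt (\<lambda>x y. h x < h y) w"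
        by (subst (asm) successively_conv_sorted_wrt) (auto simp: transp_def)
      then show ?thesis by (auto simp: distinct_conv_nth sorted_wrt_iff_nth_less nat_neq_iff)
          (metis less_irrefl)+
    qed
  qed
  then show "finite {w. A_walk G A w}"
    by (intro finite_subset[OF _ finite_subset_distinct[OF V(1)]]) auto
qed

text \<open>\<open>rho\<close> bounds every protocol from above, and the rank protocol attains it:
  each connecting set of survivors contains a walk of increasing rank.\<close>

lemma rho_hat_eq_rho:
  assumes "series_parallel G"
  shows "rho_hat G p = rho G p"
proof -
  obtain h :: "'a \<Rightarrow> real" where h:
    "\<And>F. F \<subseteq> edges G \<Longrightarrow> same_component F (sender G) (receiver G) \<Longrightarrow>
       (\<lambda>u v. {u, v} \<in> F \<and> h u < h v)\<^sup>*\<^sup>* (sender G) (receiver G)"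
    using series_parallel_rank[OF assms] by blast
  define A where "A = {(u, v, w). {u, v} \<in> edges G \<and> {v, w} \<in> edges G \<and> h u < h v \<and> h v < h w}"
  have A: "finite_protocol G A"
    unfolding A_def using assms
    by (intro finite_protocol_rank series_parallel_verts series_parallel_edges_Pow)
  have walk: "\<exists>w. A_walk G A w \<and> walk_edges w \<subseteq> F"
    if F: "F \<subseteq> edges G" "same_component F (sender G) (receiver G)" for F
  proof -
    obtain w where w: "w \<noteq> []" "hd w = sender G" "last w = receiver G"
      "successively (\<lambda>u v. {u, v} \<in> F \<and> h u < h v) w"
      by (rule rtranclp_walk[OF h[OF F]])
    then have "walk_edges w \<subseteq> F" by (auto simp: walk_edges_def successively_conv_nth)
    moreover have "(w ! i, w ! (i + 1), w ! (i + 2)) \<in> A" if "i + 2 < length w" for i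
      using w(4) that F(1) unfolding successively_conv_nth A_def by auto
    ultimately show ?thesis using w F(1) unfolding A_walk_def by blast
  qed
  have "rho G p \<le> rho_protocol G A p"
    unfolding rho_def rho_protocol_def
    by (rule measure_pmf.finite_measure_mono_AE)
      (use walk set_pmf_surviving[of G p] in \<open>auto simp: AE_measure_pmf_iff\<close>)
  then have eq: "rho_protocol G A p = rho G p" using rho_protocol_le_rho[of G A p] by simp
  \<comment> \<open>\<open>Max\<close> is meaningful only over a finite set; there are finitely many
    instructions, hence finitely many protocols.\<close>
  have "instructions G \<subseteq> verts G \<times> verts G \<times> verts G"
    using series_parallel_edges_Pow[OF assms] by (auto simp: instructions_def)
  then have "finite (instructions G)"
    by (rule finite_subset) (simp add: series_parallel_verts[OF assms])
  then have "finite {A. finite_protocol G A}"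
    by (rule rev_finite_subset[OF iffD2[OF finite_Pow_iff]]) (auto simp: finite_protocol_def)
  then have "finite {rho_protocol G A p | A. finite_protocol G A}" by (rule finite_image_set)
  then show ?thesis unfolding rho_hat_def
    using A eq rho_protocol_le_rho[of G _ p] by (intro Max_eqI) (auto intro!: exI[of _ A])
qed

section \<open>Differences of reliability functions\<close>

text \<open>The flag \<open>b\<close> asks for graphs without an edge joining sender and receiver, which may be
  composed in parallel.  The set \<open>X\<close> of vertices to be avoided takes the place of passing to
  disjoint isomorphic copies.\<close>

definition sp_reliability :: "bool \<Rightarrow> (real \<Rightarrow> real) \<Rightarrow> bool" where
  "sp_reliability b f \<longleftrightarrow> (\<forall>s r X. s \<noteq> r \<longrightarrow> finite X \<longrightarrow>
     (\<exists>G :: nat network. series_parallel G \<and> sender G = s \<and> receiver G = r \<and>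
        verts G \<inter> X \<subseteq> {s, r} \<and> (b \<longrightarrow> {s, r} \<notin> edges G) \<and> (\<forall>p\<in>{0..1}. rho G p = f p)))"

lemma sp_reliabilityE:
  assumes "sp_reliability b f" "s \<noteq> r" "finite X"
  obtains G :: "nat network" where "series_parallel G" "sender G = s" "receiver G = r"
    "verts G \<inter> X \<subseteq> {s, r}" "b \<Longrightarrow> {s, r} \<notin> edges G" "\<And>p. p \<in> {0..1} \<Longrightarrow> rho G p = f p"
  using assms(1)[unfolded sp_reliability_def, rule_format, OF assms(2,3)] that by metis

lemma sp_reliability_K2: "sp_reliability False (\<lambda>p. p)"
  unfolding sp_reliability_def
proof (intro allI impI)
  fix s r :: nat and X :: "nat set"
  assume "s \<noteq> r"
  then show "\<exists>G :: nat network. series_parallel G \<and> sender G = s \<and> receiver G = r \<and>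
      verts G \<inter> X \<subseteq> {s, r} \<and> (False \<longrightarrow> {s, r} \<notin> edges G) \<and> (\<forall>p\<in>{0..1}. rho G p = p)"
    by (intro exI[of _ "K2 s r"]) (simp add: series_parallel.K2 rho_K2, auto simp: K2_def)
qed

text \<open>The result flag \<open>d\<close> is arbitrary: in a series composition sender and
  receiver lie in different parts and are never adjacent.\<close>

lemma sp_reliability_mult:
  assumes f: "sp_reliability b f" and g: "sp_reliability c g"
  shows "sp_reliability d (\<lambda>p. f p * g p)"
  unfolding sp_reliability_def
proof (intro allI impI)
  fix s r :: nat and X :: "nat set"
  assume sr: "s \<noteq> r" and X: "finite X"
  obtain m where m: "m \<notin> X \<union> {s, r}"
    using ex_new_if_finite[of "X \<union> {s, r}"] X infinite_UNIV_nat by auto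
  \<comment> \<open>\<open>G1\<close> must also avoid \<open>r\<close>, since \<open>G2\<close> will
    avoid the vertices of \<open>G1\<close> except at its own ends.\<close>
  obtain G1 :: "nat network" where G1: "series_parallel G1" "sender G1 = s" "receiver G1 = m"
    "verts G1 \<inter> (X \<union> {r}) \<subseteq> {s, m}" "b \<Longrightarrow> {s, m} \<notin> edges G1"
    "\<And>p. p \<in> {0..1} \<Longrightarrow> rho G1 p = f p"
  proof (rule sp_reliabilityE[OF f])
    show "s \<noteq> m" "finite (X \<union> {r})" using m X by auto
  qed metis
  have V1: "s \<in> verts G1" "m \<in> verts G1" "finite (verts G1)" "r \<notin> verts G1"
    using series_parallel_verts[OF G1(1)] G1(2-4) sr m by auto
  obtain G2 :: "nat network" where G2: "series_parallel G2" "sender G2 = m" "receiver G2 = r"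
    "verts G2 \<inter> (X \<union> verts G1) \<subseteq> {m, r}" "c \<Longrightarrow> {m, r} \<notin> edges G2"
    "\<And>p. p \<in> {0..1} \<Longrightarrow> rho G2 p = g p"
  proof (rule sp_reliabilityE[OF g])
    show "m \<noteq> r" "finite (X \<union> verts G1)" using m X V1 by auto
  qed metis
  have V2: "m \<in> verts G2" "r \<in> verts G2" "s \<notin> verts G2"
    using series_parallel_verts[OF G2(1)] G2(2-4) V1 sr m by auto
  have meet: "verts G1 \<inter> verts G2 = {receiver G1}"
    using V1 V2 G1(3) G2(4) by auto
  have "verts (series G1 G2) \<inter> X \<subseteq> {s, r}"
    using G1(4) G2(4) m by (auto simp: series_def)
  moreover have "{s, r} \<notin> edges (series G1 G2)"
    using series_parallel_edges_Pow[OF G1(1)] series_parallel_edges_Pow[OF G2(1)] V1 V2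
    by (auto simp: series_def)
  moreover have "series_parallel (series G1 G2)"
    using series_parallel.series[OF G1(1) G2(1)] G1(3) G2(2) meet by simp
  moreover have "rho (series G1 G2) p = f p * g p" if "p \<in> {0..1}" for p
    using rho_series[OF G1(1) G2(1)] G1(3,6) G2(2,6) meet that by simp
  moreover have "sender (series G1 G2) = s" "receiver (series G1 G2) = r"
    using G1(2) G2(3) by (simp_all add: series_def)
  ultimately show "\<exists>G :: nat network. series_parallel G \<and> sender G = s \<and> receiver G = r \<and>
      verts G \<inter> X \<subseteq> {s, r} \<and> (d \<longrightarrow> {s, r} \<notin> edges G) \<and> (\<forall>p\<in>{0..1}. rho G p = f p * g p)"
    by blast
qed

lemma sp_reliability_parallel:
  assumes f: "sp_reliability True f" and g: "sp_reliability True g"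
  shows "sp_reliability True (\<lambda>p. f p + g p - f p * g p)"
  unfolding sp_reliability_def
proof (intro allI impI)
  fix s r :: nat and X :: "nat set"
  assume sr: "s \<noteq> r" and X: "finite X"
  obtain G1 :: "nat network" where G1: "series_parallel G1" "sender G1 = s" "receiver G1 = r"
    "verts G1 \<inter> X \<subseteq> {s, r}" "{s, r} \<notin> edges G1" "\<And>p. p \<in> {0..1} \<Longrightarrow> rho G1 p = f p"
    using sp_reliabilityE[OF f sr X] by auto
  have V1: "s \<in> verts G1" "r \<in> verts G1" "finite (verts G1)"
    using series_parallel_verts[OF G1(1)] G1(2,3) by auto
  obtain G2 :: "nat network" where G2: "series_parallel G2" "sender G2 = s" "receiver G2 = r"
    "verts G2 \<inter> (X \<union> verts G1) \<subseteq> {s, r}" "{s, r} \<notin> edges G2"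
    "\<And>p. p \<in> {0..1} \<Longrightarrow> rho G2 p = g p"
    using sp_reliabilityE[OF g sr, of "X \<union> verts G1"] X V1 by auto
  have V2: "s \<in> verts G2" "r \<in> verts G2"
    using series_parallel_verts[OF G2(1)] G2(2,3) by auto
  have meet: "verts G1 \<inter> verts G2 = {s, r}"
    using V1 V2 G2(4) by auto
  \<comment> \<open>A common edge could only join \<open>s\<close> and \<open>r\<close>, which the
    flags exclude.\<close>
  have disj: "edges G1 \<inter> edges G2 = {}"
  proof (rule ccontr)
    assume "edges G1 \<inter> edges G2 \<noteq> {}"
    then obtain e where e: "e \<in> edges G1" "e \<in> edges G2" by auto
    then have "e \<subseteq> {s, r}" "card e = 2"
      using series_parallel_simple[OF G1(1)] series_parallel_simple[OF G2(1)]
      by (auto simp flip: meet)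
    then have "e = {s, r}" using card_subset_eq[of "{s, r}" e] sr by simp
    then show False using e G1(5) by simp
  qed
  have "series_parallel (parallel G1 G2)"
    using series_parallel.parallel[OF G1(1) G2(1)] G1(2,3) G2(2,3) meet disj by simp
  moreover have "verts (parallel G1 G2) \<inter> X \<subseteq> {s, r}"
    using G1(4) G2(4) by (auto simp: parallel_def)
  moreover have "rho (parallel G1 G2) p = f p + g p - f p * g p" if "p \<in> {0..1}" for p
    using rho_parallel[OF G1(1) G2(1)] G1(2,3,6) G2(2,3,6) meet disj that by simp
  moreover have "sender (parallel G1 G2) = s" "receiver (parallel G1 G2) = r"
    "{s, r} \<notin> edges (parallel G1 G2)"
    using G1(2,3,5) G2(5) by (simp_all add: parallel_def)
  ultimately show "\<exists>G :: nat network. series_parallel G \<and> sender G = s \<and> receiver G = r \<and>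
      verts G \<inter> X \<subseteq> {s, r} \<and> (True \<longrightarrow> {s, r} \<notin> edges G) \<and>
      (\<forall>p\<in>{0..1}. rho G p = f p + g p - f p * g p)"
    by blast
qed

text \<open>A path with at least two edges does not join its ends directly, so either flag is
  possible.\<close>

lemma sp_reliability_power: "sp_reliability b (\<lambda>p. p ^ (k + 2))"
proof -
  have "sp_reliability False (\<lambda>p. p ^ Suc k)" for k
  proof (induction k)
    case 0
    then show ?case using sp_reliability_K2 by simp
  next
    case (Suc k)
    then show ?case using sp_reliability_mult[OF sp_reliability_K2 Suc] by simp
  qed
  from sp_reliability_mult[OF sp_reliability_K2 this[of k]] show ?thesis by simp
qed

text \<open>The flag \<open>True\<close> permits the parallel compositions that realise
  products.\<close>

definition sp_difference :: "(real \<Rightarrow> real) \<Rightarrow> bool" where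
  "sp_difference f \<longleftrightarrow> (\<exists>a b. sp_reliability True a \<and> sp_reliability True b \<and> f = (\<lambda>p. a p - b p))"

lemma sp_difference_mult:
  assumes "sp_difference f" "sp_difference g"
  shows "sp_difference (\<lambda>p. f p * g p)"
proof -
  from assms(1) obtain a b where ab: "sp_reliability True a" "sp_reliability True b"
    "f = (\<lambda>p. a p - b p)" unfolding sp_difference_def by blast
  from assms(2) obtain c d where cd: "sp_reliability True c" "sp_reliability True d"
    "g = (\<lambda>p. c p - d p)" unfolding sp_difference_def by blast
  \<comment> \<open>The correction terms \<open>a b c d\<close> of the two parallel compositions cancel.\<close>
  let ?u = "\<lambda>p. a p * c p + b p * d p - (a p * c p) * (b p * d p)"
  let ?v = "\<lambda>p. a p * d p + b p * c p - (a p * d p) * (b p * c p)"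
  have "sp_reliability True ?u" "sp_reliability True ?v"
    using sp_reliability_parallel[OF sp_reliability_mult[OF ab(1) cd(1)] sp_reliability_mult[OF ab(2) cd(2)]]
      sp_reliability_parallel[OF sp_reliability_mult[OF ab(1) cd(2)] sp_reliability_mult[OF ab(2) cd(1)]]
    by simp_all
  moreover have "(\<lambda>p. f p * g p) = (\<lambda>p. ?u p - ?v p)"
    by (simp add: ab(3) cd(3) algebra_simps)
  ultimately show ?thesis unfolding sp_difference_def by blast
qed

lemma sp_difference_mult_power:
  assumes "sp_difference f" "sp_difference g"
  shows "sp_difference (\<lambda>p. f p * g p ^ n)"
proof (induction n)
  case 0
  then show ?case using assms(1) by simp
next
  case (Suc n)
  then show ?case using sp_difference_mult[OF Suc assms(2)] by (simp add: mult_ac)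
qed

text \<open>The factor \<open>f\<close> starts the induction: the constant 1 is not a difference of
  reliabilities, since these all vanish at 0.\<close>

lemma sp_difference_mult_prod:
  fixes n :: nat
  assumes "sp_difference f" "\<And>i. i < n \<Longrightarrow> sp_difference (g i)"
  shows "sp_difference (\<lambda>p. f p * (\<Prod>i<n. g i p ^ m i))"
  using assms(2)
proof (induction n)
  case 0
  then show ?case using assms(1) by simp
next
  case (Suc n)
  have "sp_difference (\<lambda>p. (f p * (\<Prod>i<n. g i p ^ m i)) * g n p ^ m n)"
    using Suc by (intro sp_difference_mult_power) auto
  then show ?case by (simp add: mult_ac)
qed

text \<open>This starting factor equals \<open>p^2 * (1 - p)\<close>, so it adds no zero in
  (0,1).\<close>

lemma sp_difference_base: "sp_difference (\<lambda>p. p ^ 2 - p ^ 3)"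
  unfolding sp_difference_def
  using sp_reliability_power[of True 0] sp_reliability_power[of True 1]
  by (auto simp: numeral_eq_Suc)

section \<open>Simple zeros\<close>

text \<open>The reciprocal of the golden ratio.\<close>

definition golden :: real where "golden = (sqrt 5 - 1) / 2"

lemma golden: "golden ^ 2 + golden = 1" "0 < golden" "golden < 1"
proof -
  have "2 < sqrt 5" "sqrt 5 < 3" by (simp_all add: real_less_rsqrt real_less_lsqrt)
  then show "0 < golden" "golden < 1" by (simp_all add: golden_def)
  show "golden ^ 2 + golden = 1" by (simp add: golden_def power2_eq_square field_simps)
qed

definition golden_root :: "nat \<Rightarrow> real" where "golden_root i = root (i + 2) golden"

lemma golden_root: "golden_root i ^ (i + 2) = golden" "0 < golden_root i" "golden_root i < 1"
  unfolding golden_root_def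
proof -
  show "root (i + 2) golden ^ (i + 2) = golden"
    using golden by (intro real_root_pow_pos2) auto
qed (use golden in simp_all)

text \<open>Roots of a number in (0,1) grow with their degree, so the zeros come distinct and
  already sorted.\<close>

lemma golden_root_less: "i < j \<Longrightarrow> golden_root i < golden_root j"
  unfolding golden_root_def using golden by (intro real_root_strict_increasing) auto

text \<open>With \<open>y = p\<^sup>k\<close>, a path of \<open>k\<close> edges and two parallel paths of \<open>2k\<close> edges differ by
  \<open>y - (2y\<^sup>2 - y\<^sup>4) = y (y - 1) (y\<^sup>2 + y - 1)\<close>.\<close>

definition golden_difference :: "nat \<Rightarrow> real \<Rightarrow> real" where
  "golden_difference i p =
     p ^ (i + 2) - (p ^ (2 * (i + 2)) + p ^ (2 * (i + 2)) - p ^ (2 * (i + 2)) * p ^ (2 * (i + 2)))"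

lemma sp_difference_golden: "sp_difference (golden_difference i)"
proof -
  have "sp_reliability True (\<lambda>p. p ^ (2 * (i + 2)))"
    using sp_reliability_power[of True "2 * i + 2"] by (simp add: add.commute)
  then have "sp_reliability True (\<lambda>p. p ^ (2 * (i + 2)) + p ^ (2 * (i + 2)) - p ^ (2 * (i + 2)) * p ^ (2 * (i + 2)))"
    using sp_reliability_parallel by blast
  then show ?thesis
    unfolding sp_difference_def using sp_reliability_power[of True i]
    by (auto simp: golden_difference_def fun_eq_iff)
qed

text \<open>With \<open>y = p ^ (i + 2)\<close>, the other root of \<open>y^2 + y - 1\<close> is
  \<open>-(golden + 1)\<close>. The sum is the quotient of \<open>y - golden\<close> by
  \<open>p - golden_root i\<close>.\<close>

definition golden_cofactor :: "nat \<Rightarrow> real \<Rightarrow> real" where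
  "golden_cofactor i p = p ^ (i + 2) * (p ^ (i + 2) - 1) * (p ^ (i + 2) + golden + 1) *
     (\<Sum>j<i + 2. golden_root i ^ (i + 2 - Suc j) * p ^ j)"

lemma golden_difference_factor:
  "golden_difference i p = (p - golden_root i) * golden_cofactor i p"
proof -
  define y where "y = p ^ (i + 2)"
  have "golden_difference i p = y - (y ^ 2 + y ^ 2 - y ^ 2 * y ^ 2)"
    unfolding golden_difference_def y_def power_mult[symmetric] by (simp add: mult.commute)
  also have "\<dots> = y * (y - 1) * (y ^ 2 + y - 1)"
    by algebra
  also have "y ^ 2 + y - 1 = (y - golden) * (y + golden + 1)"
    using golden(1) by algebra
  also have "y - golden = (p - golden_root i) *
      (\<Sum>j<i + 2. golden_root i ^ (i + 2 - Suc j) * p ^ j)"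
    using power_diff_sumr2[of p "i + 2" "golden_root i"] golden_root(1)[of i] by (simp add: y_def)
  finally show ?thesis by (simp add: golden_cofactor_def y_def mult_ac)
qed

text \<open>On (0,1) the factor \<open>p ^ (i + 2) - 1\<close> is negative and the others are
  positive. Hence \<open>golden_root i\<close> is the only zero of
  \<open>golden_difference i\<close> there, and it is simple.\<close>

lemma golden_cofactor_nonzero:
  assumes "0 < p" "p < 1"
  shows "golden_cofactor i p \<noteq> 0"
proof -
  have "0 < p ^ (i + 2)" "p ^ (i + 2) < 1"
    using assms by (simp_all add: power_less_one_iff del: power_Suc)
  moreover from this(1) have "0 < p ^ (i + 2) + golden + 1" using golden(2) by linarith
  moreover have "0 < (\<Sum>j<i + 2. golden_root i ^ (i + 2 - Suc j) * p ^ j)"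
    using assms golden_root by (intro sum_pos) auto
  ultimately show ?thesis unfolding golden_cofactor_def by (intro no_zero_divisors) linarith+
qed

section \<open>Assembling the prescribed profile\<close>

theorem theorem6p3:
  fixes ms :: "nat list"
  assumes "\<forall>m\<in>set ms. m > 0"
  shows "\<exists>H1 H2 :: nat network. series_parallel H1 \<and> series_parallel H2 \<and>
           (\<forall>p\<in>{0<..<1}. Delta_rho H1 H2 p = Delta_rho_hat H1 H2 p) \<and>
           has_profile (Delta_rho H1 H2) ms"
proof -
  define n where "n = length ms"
  define F where "F p = (p ^ 2 - p ^ 3) * (\<Prod>i<n. golden_difference i p ^ (ms ! i))" for p
  have "sp_difference F"
    unfolding F_def by (intro sp_difference_mult_prod sp_difference_base sp_difference_golden)
  then obtain a b where ab: "sp_reliability True a" "sp_reliability True b" "F = (\<lambda>p. a p - b p)"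
    unfolding sp_difference_def by blast
  obtain H1 :: "nat network" where H1: "series_parallel H1" "\<And>p. p \<in> {0..1} \<Longrightarrow> rho H1 p = a p"
    using sp_reliabilityE[OF ab(1), of 0 1 "{}"] by auto
  obtain H2 :: "nat network" where H2: "series_parallel H2" "\<And>p. p \<in> {0..1} \<Longrightarrow> rho H2 p = b p"
    using sp_reliabilityE[OF ab(2), of 0 1 "{}"] by auto
  have F: "Delta_rho H1 H2 p = F p" if "0 < p" "p < 1" for p
    using that H1(2) H2(2) by (simp add: Delta_rho_def ab(3))
  \<comment> \<open>\<open>U\<close> collects all factors without zeros in (0,1), leaving only the
    powers of the linear factors.\<close>
  define U where "U p = (p ^ 2 - p ^ 3) * (\<Prod>i<n. golden_cofactor i p ^ (ms ! i))" for p
  have F_eq: "F p = U p * (\<Prod>i<n. (p - golden_root i) ^ (ms ! i))" for p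
    by (simp add: F_def U_def golden_difference_factor power_mult_distrib prod.distrib)
  have U_nz: "U p \<noteq> 0" if "0 < p" "p < 1" for p
  proof -
    have "p ^ 2 - p ^ 3 = p ^ 2 * (1 - p)" by algebra
    then show ?thesis using that golden_cofactor_nonzero[OF that] by (simp add: U_def)
  qed
  have ms_pos: "ms ! i > 0" if "i < n" for i using assms that by (simp add: n_def)
  have "zero_of_multiplicity (Delta_rho H1 H2) (golden_root j) (ms ! j)" if j: "j < n" for j
  proof -
    \<comment> \<open>The local cofactor at \<open>golden_root j\<close> omits the
      \<open>j\<close>-th linear factor.\<close>
    define g where "g p = U p * (\<Prod>i\<in>{..<n} - {j}. (p - golden_root i) ^ (ms ! i))" for p
    have "isCont g (golden_root j)"
      unfolding g_def U_def golden_cofactor_def by (intro continuous_intros)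
    moreover have "g (golden_root j) \<noteq> 0"
    proof -
      have "golden_root j \<noteq> golden_root i" if "i \<noteq> j" for i
        using that golden_root_less[of i j] golden_root_less[of j i] by (cases i j rule: linorder_cases) auto
      then show ?thesis using U_nz golden_root by (auto simp: g_def)
    qed
    \<comment> \<open>The formula for \<open>Delta_rho\<close> is known only for probabilities, so
      the factorisation is claimed near the zero.\<close>
    moreover have "\<forall>\<^sub>F p in nhds (golden_root j). p \<in> {0<..<1}"
      using golden_root[of j] by (intro eventually_nhds_in_open) auto
    then have "\<forall>\<^sub>F p in nhds (golden_root j).
        Delta_rho H1 H2 p = (p - golden_root j) ^ (ms ! j) * g p"
    proof eventually_elim
      case (elim p)
      have "(\<Prod>i<n. (p - golden_root i) ^ (ms ! i)) =
          (p - golden_root j) ^ (ms ! j) * (\<Prod>i\<in>{..<n} - {j}. (p - golden_root i) ^ (ms ! i))"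
        using j by (intro prod.remove) auto
      then show ?case using elim by (simp add: F F_eq g_def mult_ac)
    qed
    ultimately show ?thesis unfolding zero_of_multiplicity_def using ms_pos[OF j] by blast
  qed
  \<comment> \<open>Positive exponents ensure that each linear factor really produces a
    zero.\<close>
  moreover have "golden_root ` {..<n} = {p \<in> {0<..<1}. Delta_rho H1 H2 p = 0}"
    using golden_root U_nz ms_pos by (auto simp: F F_eq)
  moreover have "sorted_wrt (<) (map golden_root [0..<n])"
    by (simp add: sorted_wrt_iff_nth_less golden_root_less)
  ultimately have "has_profile (Delta_rho H1 H2) ms"
    unfolding has_profile_def
    by (intro exI[of _ "map golden_root [0..<n]"]) (auto simp: n_def lessThan_atLeast0)
  moreover have "Delta_rho H1 H2 p = Delta_rho_hat H1 H2 p" for p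
    by (simp add: Delta_rho_def Delta_rho_hat_def rho_hat_eq_rho H1(1) H2(1))
  ultimately show ?thesis using H1(1) H2(1) by blast
qed

end
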